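(* Let $G$ be a complex semisimple simply connected linear algebraic group of rank $r$ with Weyl group $W$. Let $\mathcal{I} = (i_1, i_2, \ldots, i_n) \in \{1,\dots,r\}^n$ be a (not necessarily reduced) word decomposition of an element $w = s_{i_1}\cdots s_{i_n}$ of $W$, and let $\lambda = \lambda_1 \varpi_1 + \cdots + \lambda_r \varpi_r$ be a dominant weight (so $\lambda_i\in\mathbb{Z}$, $\lambda_i \geq 0$ for all $i$). Let $\mathbf{c} = \{c_{jk}\}_{1\le j<k\le n}$ and $\mathbf{\ell} = (\ell_1,\dots,\ell_n)$ be determined from $\lambda$ and $\mathcal{I}$ by $c_{jk} = \langle \alpha_{i_k}, \alpha_{i_j}^\vee\rangle$ and $\ell_j = \langle \lambda, \alpha_{i_j}^\vee\rangle = \lambda_{i_j}$. Then the corresponding Grossberg-Karshon twisted cube $(C(\mathbf{c},\mathbf{\ell}),\rho)$ is untwisted if and only if $\mathcal{I}$ is hesitant-$\lambda$-walk-avoiding.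
   Context: Lie-theoretic notation: after fixing a Cartan subgroup and a Borel subgroup of $G$, $\alpha_1,\dots,\alpha_r$ are the simple roots, $\alpha_1^\vee,\dots,\alpha_r^\vee$ the simple coroots, $\varpi_1,\dots,\varpi_r$ the fundamental weights (so $\langle \varpi_i,\alpha_j^\vee\rangle=\delta_{ij}$), and $s_i$ is the simple reflection in $\alpha_i$. Twisted cubes: let $n$ be a positive integer, and let $\mathbf{c}=\{c_{jk}\}_{1\le j<k\le n}$ and $\mathbf{\ell}=(\ell_1,\dots,\ell_n)$ be integers. For $x\in\mathbb{R}^n$ put $A_n(x)=\ell_n$ and $A_j(x)=\ell_j-\sum_{k>j}c_{jk}x_k$ for $1\le j\le n-1$. Define $$C(\mathbf{c},\mathbf{\ell})=\{x\in\mathbb{R}^n : \text{for all } 1\le j\le n,\ A_j(x)<x_j<0 \text{ or } 0\le x_j\le A_j(x)\}.$$ Let $\mathrm{sgn}(t)=1$ for $t<0$ and $\mathrm{sgn}(t)=-1$ for $t\ge 0$, and define $\rho:\mathbb{R}^n\to\mathbb{R}$ by $\rho(x)=(-1)^n\prod_{k=1}^n\mathrm{sgn}(x_k)$ if $x\in C(\mathbf{c},\mathbf{\ell})$ and $\rho(x)=0$ otherwise. The pair $(C(\mathbf{c},\mathbf{\ell}),\rho)$ is the (Grossberg-Karshon) twisted cube associated to $\mathbf{c},\mathbf{\ell}$. It is untwisted if $C(\mathbf{c},\mathbf{\ell})$ is a closed convex polytope and $\rho$ is constant and equal to $1$ on $C(\mathbf{c},\mathbf{\ell})$ and $0$ elsewhere;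 otherwise it is twisted. Walks: a word $(i_1,\dots,i_m)$ in $\{1,\dots,r\}$ ($m\ge1$) is a diagram walk if for each $1\le j\le m-1$ the simple roots $\alpha_{i_j}$ and $\alpha_{i_{j+1}}$ are distinct and joined by an edge (of any multiplicity) in the Dynkin diagram of $G$. Its final root is $\alpha_{i_m}$. A simple root $\alpha_i$ appears in $\lambda$ if $\lambda_i=\langle\lambda,\alpha_i^\vee\rangle>0$. A word $(i_0,i_1,\dots,i_m)$ with $m\ge 1$ is a hesitant $\lambda$-walk if $i_0=i_1$, the word $(i_1,\dots,i_m)$ is a diagram walk, and $\alpha_{i_m}$ appears in $\lambda$. A word $\mathcal{I}$ is hesitant-$\lambda$-walk-avoiding if no subword (i.e. subsequence, not necessarily consecutive) of $\mathcal{I}$ is a hesitant $\lambda$-walk. *)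

theory Defs
  imports "HOL-Analysis.Analysis" "HOL-Library.Sublist"
begin

(* The group G (with its Cartan and Borel subgroups) is represented by its root system with a
   base: complex semisimple simply connected groups correspond to reduced crystallographic root
   systems, not necessarily irreducible. The space 'a is the real span of the characters of the
   Cartan subgroup, with a Weyl-invariant inner product, which also identifies it with its dual. *)

definition coroot :: "'a::euclidean_space \<Rightarrow> 'a" where
  "coroot a = (2 / (a \<bullet> a)) *\<^sub>R a"

definition root_pairing :: "'a::euclidean_space \<Rightarrow> 'a \<Rightarrow> real" where
  "root_pairing v a = v \<bullet> coroot a"

definition root_reflection :: "'a::euclidean_space \<Rightarrow> 'a \<Rightarrow> 'a" where
  "root_reflection a v = v - root_pairing v a *\<^sub>R a"

definition root_system :: "'a::euclidean_space set \<Rightarrow> bool" where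
  "root_system \<Phi> \<longleftrightarrow>
     finite \<Phi> \<and> 0 \<notin> \<Phi> \<and> span \<Phi> = UNIV \<and>
     (\<forall>a\<in>\<Phi>. root_reflection a ` \<Phi> = \<Phi>) \<and>
     (\<forall>a\<in>\<Phi>. \<forall>b\<in>\<Phi>. root_pairing b a \<in> \<int>) \<and>
     (\<forall>a\<in>\<Phi>. \<forall>t::real. t *\<^sub>R a \<in> \<Phi> \<longrightarrow> t = 1 \<or> t = -1)"

(* Only the values of \<alpha> on {1..r} are relevant; here r is the rank, necessarily DIM('a). *)
definition simple_roots :: "'a::euclidean_space set \<Rightarrow> nat \<Rightarrow> (nat \<Rightarrow> 'a) \<Rightarrow> bool" where
  "simple_roots \<Phi> r \<alpha> \<longleftrightarrow>
     inj_on \<alpha> {1..r} \<and> \<alpha> ` {1..r} \<subseteq> \<Phi> \<and> independent (\<alpha> ` {1..r}) \<and>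
     (\<forall>b\<in>\<Phi>. \<exists>m :: nat \<Rightarrow> int.
        b = (\<Sum>i=1..r. of_int (m i) *\<^sub>R \<alpha> i) \<and>
        ((\<forall>i\<in>{1..r}. 0 \<le> m i) \<or> (\<forall>i\<in>{1..r}. m i \<le> 0)))"

definition fundamental_weights :: "nat \<Rightarrow> (nat \<Rightarrow> 'a::euclidean_space) \<Rightarrow> (nat \<Rightarrow> 'a) \<Rightarrow> bool" where
  "fundamental_weights r \<alpha> \<omega> \<longleftrightarrow>
     (\<forall>i\<in>{1..r}. \<forall>j\<in>{1..r}. root_pairing (\<omega> i) (\<alpha> j) = (if i = j then 1 else 0))"

(* Inverses need no separate rule: reflections are involutions. *)
inductive_set weyl_group :: "'a::euclidean_space set \<Rightarrow> ('a \<Rightarrow> 'a) set" for \<Phi> where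
  one: "id \<in> weyl_group \<Phi>"
| refl: "a \<in> \<Phi> \<Longrightarrow> w \<in> weyl_group \<Phi> \<Longrightarrow> root_reflection a \<circ> w \<in> weyl_group \<Phi>"

definition word_product :: "(nat \<Rightarrow> 'a::euclidean_space) \<Rightarrow> nat list \<Rightarrow> 'a \<Rightarrow> 'a" where
  "word_product \<alpha> is = foldr (\<circ>) (map (\<lambda>i. root_reflection (\<alpha> i)) is) id"

(* A product of two Cartan integers, the number of edges in the usual convention. *)
definition dynkin_edges :: "(nat \<Rightarrow> 'a::euclidean_space) \<Rightarrow> nat \<Rightarrow> nat \<Rightarrow> real" where
  "dynkin_edges \<alpha> i j = root_pairing (\<alpha> i) (\<alpha> j) * root_pairing (\<alpha> j) (\<alpha> i)"

definition dynkin_joined :: "(nat \<Rightarrow> 'a::euclidean_space) \<Rightarrow> nat \<Rightarrow> nat \<Rightarrow> bool" where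
  "dynkin_joined \<alpha> i j \<longleftrightarrow> \<alpha> i \<noteq> \<alpha> j \<and> dynkin_edges \<alpha> i j \<noteq> 0"

definition diagram_walk :: "nat \<Rightarrow> (nat \<Rightarrow> 'a::euclidean_space) \<Rightarrow> nat list \<Rightarrow> bool" where
  "diagram_walk r \<alpha> is \<longleftrightarrow>
     is \<noteq> [] \<and> set is \<subseteq> {1..r} \<and> successively (dynkin_joined \<alpha>) is"

definition appears_in :: "(nat \<Rightarrow> 'a::euclidean_space) \<Rightarrow> nat \<Rightarrow> 'a \<Rightarrow> bool" where
  "appears_in \<alpha> i wt \<longleftrightarrow> root_pairing wt (\<alpha> i) > 0"

definition hesitant_walk :: "nat \<Rightarrow> (nat \<Rightarrow> 'a::euclidean_space) \<Rightarrow> 'a \<Rightarrow> nat list \<Rightarrow> bool" where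
  "hesitant_walk r \<alpha> wt is \<longleftrightarrow>
     2 \<le> length is \<and> is ! 0 = is ! 1 \<and> diagram_walk r \<alpha> (tl is) \<and> appears_in \<alpha> (last is) wt"

definition hesitant_walk_avoiding ::
  "nat \<Rightarrow> (nat \<Rightarrow> 'a::euclidean_space) \<Rightarrow> 'a \<Rightarrow> nat list \<Rightarrow> bool" where
  "hesitant_walk_avoiding r \<alpha> wt is \<longleftrightarrow>
     (\<forall>js. subseq js is \<longrightarrow> \<not> hesitant_walk r \<alpha> wt js)"

(* The positions 1 < ... < n are the elements of a finite linearly ordered type 'n. *)
definition word_of :: "('n::{finite,linorder} \<Rightarrow> nat) \<Rightarrow> nat list" where
  "word_of i = map i (sorted_list_of_set UNIV)"

(* For the last position the sum is empty. Entries c j k with j \<ge> k are never used. *)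
definition cube_bound ::
  "('n::{finite,linorder} \<Rightarrow> 'n \<Rightarrow> int) \<Rightarrow> ('n \<Rightarrow> int) \<Rightarrow> real^'n::{finite,linorder} \<Rightarrow> 'n \<Rightarrow> real" where
  "cube_bound c l x j = of_int (l j) - (\<Sum>k\<in>{j<..}. of_int (c j k) * x $ k)"

definition twisted_cube ::
  "('n::{finite,linorder} \<Rightarrow> 'n \<Rightarrow> int) \<Rightarrow> ('n \<Rightarrow> int) \<Rightarrow> (real^'n::{finite,linorder}) set" where
  "twisted_cube c l =
     {x. \<forall>j. (cube_bound c l x j < x $ j \<and> x $ j < 0) \<or> (0 \<le> x $ j \<and> x $ j \<le> cube_bound c l x j)}"

(* Not the library function sgn: the sign is reversed and 0 counts as nonnegative. *)
definition cube_sgn :: "real \<Rightarrow> real" where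
  "cube_sgn t = (if t < 0 then 1 else -1)"

definition cube_density ::
  "('n::{finite,linorder} \<Rightarrow> 'n \<Rightarrow> int) \<Rightarrow> ('n \<Rightarrow> int) \<Rightarrow> real^'n::{finite,linorder} \<Rightarrow> real" where
  "cube_density c l x =
     (if x \<in> twisted_cube c l then (-1) ^ CARD('n) * (\<Prod>k\<in>UNIV. cube_sgn (x $ k)) else 0)"

(* The library predicate polytope means convex hull of a finite set, hence closed and convex. *)
definition untwisted :: "(real^'n) set \<Rightarrow> (real^'n \<Rightarrow> real) \<Rightarrow> bool" where
  "untwisted C \<rho> \<longleftrightarrow> polytope C \<and> (\<forall>x\<in>C. \<rho> x = 1) \<and> (\<forall>x. x \<notin> C \<longrightarrow> \<rho> x = 0)"

end

theory Submission
  imports Defs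
begin

text \<open>
  The twisted cube is untwisted exactly when all its points have nonnegative coordinates
  (lemma \<open>untwisted_iff_nonnegative\<close>). If they do, the cube is cut out by the finitely many weak
  inequalities \<open>0 \<le> x\<^sub>j \<le> A\<^sub>j(x)\<close> and is bounded, so it is a polytope on which the density is 1.
  If some point has a negative coordinate \<open>x\<^sub>k\<close>, then \<open>A\<^sub>k(x) < x\<^sub>k < 0\<close>, and \<open>x\<^sub>k\<close> can be pushed
  towards 0 within the cube while the later coordinates stay fixed; as the value 0 is not
  allowed, the cube is not compact.

  Both remaining implications follow from a look at the bounds
  \<open>A\<^sub>j(x) = \<ell>\<^sub>j - \<Sum>\<^sub>k c\<^sub>j\<^sub>k x\<^sub>k\<close>, in which \<open>\<ell>\<^sub>j \<ge> 0\<close>, and \<open>c\<^sub>j\<^sub>k\<close> is 2 for equal letters, negative for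
  letters joined in the Dynkin diagram and 0 otherwise.

  Suppose \<open>x\<^sub>k\<close> is the last negative coordinate of a point of the cube. Then \<open>A\<^sub>k(x) < 0\<close>, so some
  later position \<open>j\<close> with the same letter has \<open>x\<^sub>j > 0\<close>. A positive coordinate forces \<open>A\<^sub>j(x) > 0\<close>,
  hence either \<open>\<ell>\<^sub>j > 0\<close> or there is a later positive coordinate at a joined letter. Following
  these positive coordinates gives a diagram walk that ends at a letter appearing in the weight,
  and \<open>k\<close> in front of it makes the walk hesitant (lemma \<open>nonnegative_if_avoiding\<close>).

  Conversely, a shortest hesitant walk \<open>(p, q, \<dots>)\<close> has no repeated letter after its first position.
  Take the point with \<open>x\<^sub>j = A\<^sub>j(x)\<close> at the positions from \<open>q\<close> on in the walk and \<open>x\<^sub>j = 0\<close> elsewhere.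
  If the cube had only nonnegative points, this one would lie in it. Going backwards along the
  walk, all its coordinates there are positive: as the letters are distinct, the bound at a walk
  position gets only nonnegative contributions, and the one from the next position is positive
  because consecutive letters are joined; at the end of the walk the weight contributes. But then
  \<open>A\<^sub>p(x) = A\<^sub>q(x) - 2 x\<^sub>q = - x\<^sub>q < 0\<close>
  (lemma \<open>avoiding_if_nonnegative\<close>).
\<close>

section \<open>Twisted cubes without negative coordinates\<close>

lemma cube_bound_cong:
  assumes "\<And>k. j < k \<Longrightarrow> x $ k = y $ k"
  shows "cube_bound c l x j = cube_bound c l y j"
  unfolding cube_bound_def using assms by (auto intro!: sum.cong)

text \<open>Since each bound only involves later coordinates, coordinates can be chosen one after the
  other from the last to the first, each as a function of its bound.\<close>

lemma exists_point_with_prescribed_coordinates: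
  fixes c :: "'n::{finite,linorder} \<Rightarrow> 'n \<Rightarrow> int"
  shows "\<exists>x :: real^'n::{finite,linorder}. \<forall>j. x $ j = f j (cube_bound c l x j)"
proof -
  have "\<exists>x::real^'n::{finite,linorder}. \<forall>j\<in>A. x $ j =
      f j (of_int (l j) - (\<Sum>k\<in>{k\<in>A. j < k}. of_int (c j k) * x $ k))"
    if "finite A" for A
    using that
  proof (induction A rule: finite_linorder_min_induct)
    case empty
    then show ?case by simp
  next
    case (insert b A)
    then obtain x :: "real^'n::{finite,linorder}"
      where x: "\<forall>j\<in>A. x $ j = f j (of_int (l j) - (\<Sum>k\<in>{k\<in>A. j < k}. of_int (c j k) * x $ k))"
      by blast
    define t where "t = f b (of_int (l b) - (\<Sum>k\<in>A. of_int (c b k) * x $ k))"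
    define y where "y = (\<chi> j. if j = b then t else x $ j)"
    have same: "y $ j = x $ j" if "j \<in> A" for j
      using that insert.hyps by (auto simp: y_def)
    have "{k \<in> insert b A. b < k} = A"
      using insert.hyps by auto
    moreover have "{k \<in> insert b A. j < k} = {k \<in> A. j < k}" if "j \<in> A" for j
      using that insert.hyps by auto
    moreover have "y $ b = t"
      by (simp add: y_def)
    moreover have "(\<Sum>k\<in>{k\<in>A. P k}. of_int (c j k) * y $ k)
        = (\<Sum>k\<in>{k\<in>A. P k}. of_int (c j k) * x $ k)" for P j
      by (intro sum.cong) (auto simp: same)
    moreover have "(\<Sum>k\<in>A. of_int (c b k) * y $ k) = (\<Sum>k\<in>A. of_int (c b k) * x $ k)"
      by (intro sum.cong) (auto simp: same)
    ultimately have "\<forall>j\<in>insert b A. y $ j =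
        f j (of_int (l j) - (\<Sum>k\<in>{k\<in>insert b A. j < k}. of_int (c j k) * y $ k))"
      using x by (simp add: same t_def)
    then show ?case by blast
  qed
  from this[OF finite[of UNIV]] show ?thesis
    by (simp add: cube_bound_def greaterThan_def)
qed

lemma polyhedron_nonnegative_cube:
  "polyhedron {x :: real^'n::{finite,linorder}. \<forall>j. 0 \<le> x $ j \<and> x $ j \<le> cube_bound c l x j}"
proof -
  define a :: "'n \<Rightarrow> real^'n::{finite,linorder}"
    where "a j = axis j 1 + (\<Sum>k\<in>{j<..}. of_int (c j k) *\<^sub>R axis k 1)" for j
  have a: "a j \<bullet> x = x $ j + (\<Sum>k\<in>{j<..}. of_int (c j k) * x $ k)" for j x
    by (simp add: a_def inner_add_left inner_sum_left inner_axis' )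
  have "{x. \<forall>j. 0 \<le> x $ j \<and> x $ j \<le> cube_bound c l x j} =
      (\<Inter>j\<in>UNIV. {x. axis j 1 \<bullet> x \<ge> 0} \<inter> {x. a j \<bullet> x \<le> of_int (l j)})"
    by (auto simp: a inner_axis' cube_bound_def algebra_simps)
  also have "polyhedron \<dots>"
    by (intro polyhedron_Inter)
      (auto intro!: polyhedron_Int polyhedron_halfspace_le polyhedron_halfspace_ge)
  finally show ?thesis .
qed

text \<open>Bounds on the later coordinates bound \<open>A\<^sub>j\<close> and hence the coordinate below it.\<close>

lemma bounded_nonnegative_cube:
  "bounded {x :: real^'n::{finite,linorder}. \<forall>j. 0 \<le> x $ j \<and> x $ j \<le> cube_bound c l x j}"
proof -
  define P where "P = {x :: real^'n::{finite,linorder}. \<forall>j. 0 \<le> x $ j \<and> x $ j \<le> cube_bound c l x j}"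
  have "\<exists>B. \<forall>x\<in>P. \<bar>x $ j\<bar> \<le> B" for j
  proof (induction j rule: measure_induct_rule[of "\<lambda>j. card {j<..}"])
    case (less j)
    have "\<exists>B. \<forall>x\<in>P. \<bar>x $ k\<bar> \<le> B" if "j < k" for k
      using that by (intro less psubset_card_mono) auto
    then obtain B where B: "\<And>k x. j < k \<Longrightarrow> x \<in> P \<Longrightarrow> \<bar>x $ k\<bar> \<le> B k"
      by metis
    have "\<bar>x $ j\<bar> \<le> of_int (l j) + (\<Sum>k\<in>{j<..}. \<bar>of_int (c j k)\<bar> * B k)" if x: "x \<in> P" for x
    proof -
      have "- (\<Sum>k\<in>{j<..}. of_int (c j k) * x $ k) \<le> (\<Sum>k\<in>{j<..}. \<bar>of_int (c j k) * x $ k\<bar>)"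
        using sum_abs[of "\<lambda>k. of_int (c j k) * x $ k" "{j<..}"] by linarith
      also have "\<dots> \<le> (\<Sum>k\<in>{j<..}. \<bar>of_int (c j k)\<bar> * B k)"
        using B[OF _ x] by (intro sum_mono) (auto simp: abs_mult intro!: mult_left_mono)
      finally show ?thesis
        using x by (auto simp: P_def cube_bound_def dest!: spec[of _ j])
    qed
    then show ?case by blast
  qed
  then obtain B where B: "\<And>x j. x \<in> P \<Longrightarrow> \<bar>x $ j\<bar> \<le> B j"
    by metis
  have "norm x \<le> (\<Sum>j\<in>UNIV. B j)" if "x \<in> P" for x
    using norm_le_l1_cart[of x] sum_mono[of UNIV "\<lambda>j. \<bar>x $ j\<bar>" B] B[OF that]
    by (meson order_trans)
  then show ?thesis
    unfolding P_def[symmetric] by (auto simp: bounded_iff)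
qed

text \<open>Fix the coordinates after a negative one \<open>x\<^sub>k\<close>. On this slice of the cube \<open>A\<^sub>k\<close> is a negative
  constant, so the \<open>k\<close>-th coordinate stays negative, and halving it moves it up within the slice.
  Hence it has no maximum there, which is impossible on a compact set.\<close>

lemma nonnegative_if_compact_twisted_cube:
  fixes c :: "'n::{finite,linorder} \<Rightarrow> 'n \<Rightarrow> int"
  assumes compact: "compact (twisted_cube c l)" and x: "x \<in> twisted_cube c l"
  shows "0 \<le> x $ k"
proof (rule ccontr)
  assume "\<not> 0 \<le> x $ k"
  with x have neg: "cube_bound c l x k < 0"
    unfolding twisted_cube_def by (smt (verit) mem_Collect_eq)
  define K where "K = twisted_cube c l \<inter> (\<Inter>j\<in>{k<..}. {y. y $ j = x $ j})"
  have K: "cube_bound c l y k = cube_bound c l x k" if "y \<in> K" for y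
    using that by (intro cube_bound_cong) (auto simp: K_def)
  have "compact K"
    unfolding K_def by (intro compact_Int_closed compact closed_INT ballI closed_Collect_eq)
      (auto intro!: continuous_intros)
  moreover have "x \<in> K"
    using x by (auto simp: K_def)
  moreover have "continuous_on K (\<lambda>y. y $ k)"
    by (intro continuous_intros)
  ultimately obtain y where y: "y \<in> K" and max: "\<And>z. z \<in> K \<Longrightarrow> z $ k \<le> y $ k"
    using continuous_attains_sup[of K "\<lambda>y. y $ k"] by blast
  have yC: "\<And>j. cube_bound c l y j < y $ j \<and> y $ j < 0 \<or> 0 \<le> y $ j \<and> y $ j \<le> cube_bound c l y j"
    using y by (auto simp: K_def twisted_cube_def)
  have yk: "cube_bound c l x k < y $ k" "y $ k < 0"
    using yC[of k] neg K[OF y] by linarith+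
  define f where "f j b =
    (if k < j then y $ j else if j = k then y $ k / 2 else if b < 0 then b / 2 else 0)" for j b
  obtain z where "\<forall>j. z $ j = f j (cube_bound c l z j)"
    using exists_point_with_prescribed_coordinates[of f c l] by blast
  note z = this[unfolded f_def, rule_format]
  have zy: "cube_bound c l z j = cube_bound c l y j" if "k \<le> j" for j
    using that by (intro cube_bound_cong) (auto simp: z)
  have "cube_bound c l z j < z $ j \<and> z $ j < 0 \<or> 0 \<le> z $ j \<and> z $ j \<le> cube_bound c l z j" for j
  proof (cases j k rule: linorder_cases)
    case less
    then show ?thesis using z[of j] by (auto split: if_splits)
  next
    case equal
    then show ?thesis using z[of k] zy[of k] K[OF y] yk by auto
  next
    case greater
    then show ?thesis using z[of j] zy[of j] yC[of j] by auto
  qed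
  moreover have "z $ j = x $ j" if "k < j" for j
    using that z[of j] y by (auto simp: K_def)
  ultimately have "z \<in> K"
    by (auto simp: K_def twisted_cube_def)
  from max[OF this] show False
    using z[of k] yk by simp
qed

lemma untwisted_iff_nonnegative:
  fixes c :: "'n::{finite,linorder} \<Rightarrow> 'n \<Rightarrow> int"
  shows "untwisted (twisted_cube c l) (cube_density c l) \<longleftrightarrow>
    (\<forall>x\<in>twisted_cube c l. \<forall>j. 0 \<le> x $ j)"
proof
  assume "untwisted (twisted_cube c l) (cube_density c l)"
  then show "\<forall>x\<in>twisted_cube c l. \<forall>j. 0 \<le> x $ j"
    using nonnegative_if_compact_twisted_cube polytope_imp_compact
    unfolding untwisted_def by blast
next
  assume nonneg: "\<forall>x\<in>twisted_cube c l. \<forall>j. 0 \<le> x $ j"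
  have "twisted_cube c l = {x. \<forall>j. 0 \<le> x $ j \<and> x $ j \<le> cube_bound c l x j}" (is "_ = ?P")
  proof (intro equalityI subsetI)
    fix x assume "x \<in> twisted_cube c l"
    with nonneg show "x \<in> ?P"
      unfolding twisted_cube_def by (smt (verit) mem_Collect_eq)
  qed (auto simp: twisted_cube_def)
  moreover have "cube_density c l x = 1" if "x \<in> twisted_cube c l" for x
  proof -
    have "(\<Prod>k\<in>UNIV. cube_sgn (x $ k)) = (\<Prod>k\<in>(UNIV::'n set). - 1)"
      using that nonneg by (intro prod.cong) (auto simp: cube_sgn_def not_less)
    then show ?thesis
      using that by (simp add: cube_density_def flip: power_mult_distrib)
  qed
  ultimately show "untwisted (twisted_cube c l) (cube_density c l)"
    using polyhedron_nonnegative_cube[of c l] bounded_nonnegative_cube[of c l]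
    by (auto simp: untwisted_def polytope_eq_bounded_polyhedron cube_density_def)
qed

section \<open>Walks of positions and signs of coordinates\<close>

text \<open>\<open>a\<close> has the sign pattern of a Cartan matrix, and \<open>lam\<close> stands for the coefficients of a
  dominant weight. As \<open>c\<close> and \<open>l\<close> depend on the letters alone, positions with the same letter have
  bounds of the same form, which is what hesitation exploits.\<close>

locale cartan_cube =
  fixes i :: "'n::{finite,linorder} \<Rightarrow> 'b"
    and a :: "'b \<Rightarrow> 'b \<Rightarrow> real"
    and lam :: "'b \<Rightarrow> real"
    and c :: "'n \<Rightarrow> 'n \<Rightarrow> int"
    and l :: "'n \<Rightarrow> int"
  assumes c_eq: "j < k \<Longrightarrow> of_int (c j k) = a (i j) (i k)"
    and l_eq: "of_int (l j) = lam (i j)"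
    and diagonal: "a (i j) (i j) = 2"
    and off_diagonal: "i j \<noteq> i k \<Longrightarrow> a (i j) (i k) \<le> 0"
    and dominant: "0 \<le> lam (i j)"
begin

text \<open>Walks are lists of positions instead of letters, so that each step has a coordinate.\<close>

definition walk :: "'n list \<Rightarrow> bool" where
  "walk ps \<longleftrightarrow> ps \<noteq> [] \<and> successively (\<lambda>j k. i j \<noteq> i k \<and> a (i j) (i k) < 0) ps
     \<and> 0 < lam (i (last ps))"

definition hesitant :: "'n list \<Rightarrow> bool" where
  "hesitant ps \<longleftrightarrow>
     (\<exists>p q qs. ps = p # q # qs \<and> sorted_wrt (<) ps \<and> i p = i q \<and> walk (q # qs))"

lemma cube_bound_eq:
  "cube_bound c l x j = lam (i j) - (\<Sum>k\<in>{j<..}. a (i j) (i k) * x $ k)"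
  unfolding cube_bound_def by (auto simp: l_eq c_eq intro!: sum.cong)

text \<open>A positive coordinate has a positive bound, so either its letter appears in the weight or a
  later positive coordinate with a joined letter contributes to the bound. This is iterated.\<close>

lemma walk_from_positive_coordinate:
  assumes "0 < x $ j"
    and "\<And>k. j \<le> k \<Longrightarrow> 0 \<le> x $ k \<and> x $ k \<le> cube_bound c l x k"
  shows "\<exists>qs. sorted_wrt (<) (j # qs) \<and> walk (j # qs)"
  using assms
proof (induction j rule: measure_induct_rule[of "\<lambda>j. card {j<..}"])
  case (less j)
  show ?case
  proof (cases "0 < lam (i j)")
    case True
    then have "walk [j]" by (simp add: walk_def)
    then show ?thesis by (intro exI[of _ "[]"]) simp
  next
    case False
    with less.prems(1) less.prems(2)[of j] have "0 < - (\<Sum>k\<in>{j<..}. a (i j) (i k) * x $ k)"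
      by (auto simp: cube_bound_eq)
    then obtain k where k: "j < k" "a (i j) (i k) * x $ k < 0"
      using sum_nonneg[of "{j<..}" "\<lambda>k. a (i j) (i k) * x $ k"] by (force simp: not_le)
    then have neg: "a (i j) (i k) < 0" and pos: "0 < x $ k"
      using less.prems(2)[OF less_imp_le[OF k(1)]] by (auto simp: mult_less_0_iff)
    have "\<exists>qs. sorted_wrt (<) (k # qs) \<and> walk (k # qs)"
      using k pos less.prems(2) by (intro less.IH psubset_card_mono) auto
    then obtain qs where qs: "sorted_wrt (<) (k # qs)" "walk (k # qs)" by blast
    have "i j \<noteq> i k"
      using neg diagonal[of j] by auto
    with qs neg have "walk (j # k # qs)"
      by (simp add: walk_def)
    moreover have "sorted_wrt (<) (j # k # qs)"
      using qs k by auto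
    ultimately show ?thesis by blast
  qed
qed

text \<open>At the last negative coordinate the bound is negative. Only a later positive coordinate with
  the same letter can make it so, and the walk from there is hesitant with one more step in
  front.\<close>

lemma nonnegative_if_avoiding:
  assumes avoid: "\<And>ps. \<not> hesitant ps" and x: "x \<in> twisted_cube c l"
  shows "0 \<le> x $ j"
proof (induction j rule: measure_induct_rule[of "\<lambda>j. card {j<..}"])
  case (less j)
  have C: "cube_bound c l x k < x $ k \<and> x $ k < 0 \<or> 0 \<le> x $ k \<and> x $ k \<le> cube_bound c l x k" for k
    using x by (auto simp: twisted_cube_def)
  have later: "0 \<le> x $ k \<and> x $ k \<le> cube_bound c l x k" if "j < k" for k
  proof -
    have "0 \<le> x $ k"
      using that by (intro less psubset_card_mono) auto
    then show ?thesis using C[of k] by linarith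
  qed
  show ?case
  proof (rule ccontr)
    assume "\<not> 0 \<le> x $ j"
    then have "lam (i j) - (\<Sum>k\<in>{j<..}. a (i j) (i k) * x $ k) < 0"
      using C[of j] cube_bound_eq[of x j] by linarith
    then have "\<not> (\<Sum>k\<in>{j<..}. a (i j) (i k) * x $ k) \<le> 0"
      using dominant[of j] by linarith
    then obtain k where k: "j < k" "0 < a (i j) (i k) * x $ k"
      using sum_nonpos[of "{j<..}" "\<lambda>k. a (i j) (i k) * x $ k"] by (force simp: not_le)
    then have "0 < a (i j) (i k)" and pos: "0 < x $ k"
      using later[of k] by (auto simp: zero_less_mult_iff)
    then have "i j = i k"
      using off_diagonal[of j k] by fastforce
    moreover have "\<exists>qs. sorted_wrt (<) (k # qs) \<and> walk (k # qs)"
      using k later by (intro walk_from_positive_coordinate[OF pos]) auto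
    then obtain qs where "sorted_wrt (<) (k # qs)" "walk (k # qs)" by blast
    ultimately have "hesitant (j # k # qs)"
      using k by (auto simp: hesitant_def)
    with avoid show False by blast
  qed
qed

text \<open>If a letter occurs at two positions \<open>u\<close>, \<open>v\<close> of the walk part, then dropping everything before
  \<open>u\<close> and between \<open>u\<close> and \<open>v\<close> leaves a shorter hesitant walk.\<close>

lemma hesitant_walk_with_distinct_letters:
  assumes "hesitant ps"
  obtains p q qs where "hesitant (p # q # qs)" "distinct (map i (q # qs))"
proof -
  define ps' where "ps' = arg_min length hesitant"
  have ps': "hesitant ps'"
    unfolding ps'_def by (rule arg_min_natI[of hesitant, OF assms])
  have shortest: "length ps' \<le> length rs" if "hesitant rs" for rs
    unfolding ps'_def by (rule arg_min_nat_le[of hesitant, OF that])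
  from ps' obtain p q qs where eq: "ps' = p # q # qs" and sorted: "sorted_wrt (<) ps'"
    and walk: "walk (q # qs)"
    unfolding hesitant_def by blast
  have "distinct (map i (q # qs))"
  proof (rule ccontr)
    assume "\<not> distinct (map i (q # qs))"
    then obtain xs y ys zs where "map i (q # qs) = xs @ y # ys @ y # zs"
      using not_distinct_decomp[of "map i (q # qs)"] by auto
    then obtain as u bs v cs
      where dec: "q # qs = as @ [u] @ bs @ [v] @ cs" and uv: "i u = i v"
      unfolding map_eq_append_conv Cons_eq_map_conv append_eq_map_conv by fastforce
    have "walk (v # cs)"
      using walk unfolding dec by (simp add: walk_def successively_append_iff successively_Cons)
    moreover have "sorted_wrt (<) (u # v # cs)"
      using sorted unfolding eq dec by (auto simp: sorted_wrt_append)
    ultimately have "hesitant (u # v # cs)"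
      using uv by (auto simp: hesitant_def)
    from shortest[OF this] show False
      using arg_cong[OF dec, of length] by (simp add: eq)
  qed
  with ps' show ?thesis using that unfolding eq by blast
qed

text \<open>Induction from the end of the walk. For distinct letters all terms of \<open>A\<^sub>q(x)\<close> are nonnegative;
  the term of the next position in the walk, or \<open>lam\<close> at the last position, is positive.\<close>

lemma positive_along_walk:
  assumes "sorted_wrt (<) (q # qs)" "distinct (map i (q # qs))" "walk (q # qs)"
    and "\<And>j. j \<in> set (q # qs) \<Longrightarrow> x $ j = cube_bound c l x j"
    and "\<And>j. q < j \<Longrightarrow> j \<notin> set qs \<Longrightarrow> x $ j = 0"
  shows "\<forall>j\<in>set (q # qs). 0 < x $ j"
  using assms
proof (induction qs arbitrary: q)
  case Nil
  then have "(\<Sum>k\<in>{q<..}. a (i q) (i k) * x $ k) = 0"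
    by (intro sum.neutral) auto
  with Nil show ?case
    by (simp add: cube_bound_eq walk_def)
next
  case (Cons q' qs)
  have "\<forall>j\<in>set (q' # qs). 0 < x $ j"
  proof (rule Cons.IH)
    show "x $ j = 0" if "q' < j" "j \<notin> set qs" for j
      using that Cons.prems(1) by (intro Cons.prems(5)) auto
  qed (use Cons.prems in \<open>auto simp: walk_def\<close>)
  then have pos: "0 < x $ j" if "j \<in> set (q' # qs)" for j
    using that by blast
  have "(\<Sum>k\<in>{q<..}. a (i q) (i k) * x $ k) = (\<Sum>k\<in>set (q' # qs). a (i q) (i k) * x $ k)"
    using Cons.prems(1,5) by (intro sum.mono_neutral_right) auto
  also have "\<dots> = a (i q) (i q') * x $ q' + (\<Sum>k\<in>set qs. a (i q) (i k) * x $ k)"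
    using Cons.prems(1) by (auto intro!: sum.insert)
  also have "\<dots> < 0"
  proof (rule add_neg_nonpos)
    show "a (i q) (i q') * x $ q' < 0"
      using Cons.prems(3) pos[of q'] by (auto simp: walk_def mult_neg_pos)
    have "a (i q) (i k) * x $ k \<le> 0" if "k \<in> set qs" for k
    proof -
      have "i q \<noteq> i k"
        using that Cons.prems(2) by auto
      then show ?thesis
        using off_diagonal[of q k] pos[of k] that by (simp add: mult_nonpos_nonneg)
    qed
    then show "(\<Sum>k\<in>set qs. a (i q) (i k) * x $ k) \<le> 0"
      by (rule sum_nonpos)
  qed
  finally have "0 < cube_bound c l x q"
    using dominant[of q] by (simp add: cube_bound_eq)
  then show ?case
    using Cons.prems(4)[of q] pos by auto
qed

lemma avoiding_if_nonnegative:
  assumes nonneg: "\<And>x j. x \<in> twisted_cube c l \<Longrightarrow> 0 \<le> x $ j"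
  shows "\<not> hesitant ps"
proof
  assume "hesitant ps"
  then obtain p q qs where h: "hesitant (p # q # qs)" and dist: "distinct (map i (q # qs))"
    by (rule hesitant_walk_with_distinct_letters)
  from h have sorted: "sorted_wrt (<) (p # q # qs)" and pq: "i p = i q" and walk: "walk (q # qs)"
    by (auto simp: hesitant_def)
  \<comment> \<open>The choice for negative bounds only serves to make \<open>x\<close> a point of the cube.\<close>
  define f where "f j b = (if b < 0 then b / 2 else if j \<in> set (q # qs) then b else 0)"
    for j and b :: real
  obtain x where "\<forall>j. x $ j = f j (cube_bound c l x j)"
    using exists_point_with_prescribed_coordinates[of f c l] by blast
  note x = this[unfolded f_def, rule_format]
  have "cube_bound c l x j < x $ j \<and> x $ j < 0 \<or> 0 \<le> x $ j \<and> x $ j \<le> cube_bound c l x j" for j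
    using x[of j] by (auto split: if_splits)
  then have "x \<in> twisted_cube c l"
    by (simp add: twisted_cube_def)
  then have "0 \<le> x $ j" for j
    by (rule nonneg)
  then have bound: "0 \<le> cube_bound c l x j" for j
    using x[of j] by (smt (verit) divide_less_0_iff)
  have on: "x $ j = cube_bound c l x j" if "j \<in> set (q # qs)" for j
    using that x[of j] bound[of j] by auto
  have off: "x $ j = 0" if "j \<notin> set (q # qs)" for j
    using that x[of j] bound[of j] by auto
  have "0 < x $ q"
    using positive_along_walk[OF _ dist walk, of x] sorted on off by auto
  moreover have "cube_bound c l x p = cube_bound c l x q - 2 * x $ q"
  proof -
    \<comment> \<open>Between \<open>p\<close> and \<open>q\<close> all coordinates vanish, and the two rows of the matrix agree.\<close>
    have "(\<Sum>k\<in>{p<..}. a (i p) (i k) * x $ k) = (\<Sum>k\<in>{q..}. a (i q) (i k) * x $ k)"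
      unfolding pq using sorted off by (intro sum.mono_neutral_right) (force intro!: off)+
    also have "\<dots> = 2 * x $ q + (\<Sum>k\<in>{q<..}. a (i q) (i k) * x $ k)"
    proof -
      have "{q..} = insert q {q<..}" by auto
      then show ?thesis by (simp add: diagonal)
    qed
    finally show ?thesis
      by (simp add: cube_bound_eq pq)
  qed
  ultimately show False
    using bound[of p] on[of q] by simp
qed

lemma untwisted_iff_no_hesitant:
  "untwisted (twisted_cube c l) (cube_density c l) \<longleftrightarrow> (\<forall>ps. \<not> hesitant ps)"
  using nonnegative_if_avoiding avoiding_if_nonnegative untwisted_iff_nonnegative by blast

end

section \<open>Cartan integers\<close>

lemma root_pairing_eq: "root_pairing v b = 2 * (v \<bullet> b) / (b \<bullet> b)"
  by (simp add: root_pairing_def coroot_def)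

text \<open>The reflection of \<open>\<alpha> p\<close> in \<open>\<alpha> q\<close> is a root with coefficient 1 at \<open>\<alpha> p\<close>, so its coefficient
  at \<open>\<alpha> q\<close>, the negative of the Cartan integer, cannot be negative.\<close>

lemma root_pairing_simple_roots_nonpos:
  assumes root: "root_system \<Phi>" and simple: "simple_roots \<Phi> r \<alpha>"
    and p: "p \<in> {1..r}" and q: "q \<in> {1..r}" and "p \<noteq> q"
  shows "root_pairing (\<alpha> p) (\<alpha> q) \<le> 0"
proof -
  define t where "t = root_pairing (\<alpha> p) (\<alpha> q)"
  have inj: "inj_on \<alpha> {1..r}" and indep: "independent (\<alpha> ` {1..r})"
    and "\<alpha> p \<in> \<Phi>" "\<alpha> q \<in> \<Phi>"
    using simple p q by (auto simp: simple_roots_def)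
  then have "root_reflection (\<alpha> q) (\<alpha> p) \<in> \<Phi>"
    using root unfolding root_system_def by blast
  then obtain m :: "nat \<Rightarrow> int"
    where m: "\<alpha> p - t *\<^sub>R \<alpha> q = (\<Sum>k=1..r. of_int (m k) *\<^sub>R \<alpha> k)"
      and sign: "(\<forall>k\<in>{1..r}. 0 \<le> m k) \<or> (\<forall>k\<in>{1..r}. m k \<le> 0)"
    using simple unfolding simple_roots_def root_reflection_def t_def by blast
  define u where "u k = of_int (m k) - (if k = p then 1 else 0) + (if k = q then t else 0)" for k
  have "(\<Sum>k=1..r. u k *\<^sub>R \<alpha> k) = (\<Sum>k=1..r. of_int (m k) *\<^sub>R \<alpha> k) - \<alpha> p + t *\<^sub>R \<alpha> q"
    using p q unfolding u_def
    by (simp add: scaleR_left.add scaleR_left.diff sum.distrib sum_subtractf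
        if_distrib[of "\<lambda>s. s *\<^sub>R _"] cong: if_cong)
  also have "\<dots> = 0"
    unfolding m[symmetric] by simp
  finally have "(\<Sum>v\<in>\<alpha> ` {1..r}. u (the_inv_into {1..r} \<alpha> v) *\<^sub>R v) = 0"
    by (simp add: sum.reindex[OF inj] the_inv_into_f_f[OF inj] del: One_nat_def)
  then have "u k = 0" if "k \<in> {1..r}" for k
    using independentD[OF indep _ subset_refl, of "\<lambda>v. u (the_inv_into {1..r} \<alpha> v)" "\<alpha> k"] that
    by (simp add: the_inv_into_f_f[OF inj] del: One_nat_def)
  from this[OF p] this[OF q] have "m p = 1" "of_int (m q) = - t"
    using \<open>p \<noteq> q\<close> by (simp_all add: u_def)
  then have "0 \<le> m q"
    using sign p q by force
  with \<open>of_int (m q) = - t\<close> show ?thesis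
    unfolding t_def by linarith
qed

section \<open>Words and positions\<close>

lemma subseq_map_iff:
  "subseq js (map f xs) \<longleftrightarrow> (\<exists>ys. subseq ys xs \<and> js = map f ys)"
  by (auto simp: subseq_conv_nths nths_map)

lemma subseq_sorted_list_of_UNIV_iff:
  "subseq ps (sorted_list_of_set (UNIV :: 'n::{finite,linorder} set)) \<longleftrightarrow> sorted_wrt (<) ps"
proof
  assume "subseq ps (sorted_list_of_set (UNIV :: 'n set))"
  then show "sorted_wrt (<) ps"
    using strict_sorted_list_of_set[of "UNIV :: 'n set"]
    by (auto simp: subseq_conv_nths strict_sorted_iff sorted_nths)
next
  assume "sorted_wrt (<) ps"
  then have "filter (\<lambda>p. p \<in> set ps) (sorted_list_of_set UNIV) = ps"
    by (intro sorted_distinct_set_unique)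
      (auto simp: strict_sorted_iff intro: sorted_filter[of "\<lambda>x. x", simplified])
  then show "subseq ps (sorted_list_of_set UNIV)"
    by (metis subseq_filter_left)
qed

lemma subseq_word_of_iff:
  "subseq js (word_of i) \<longleftrightarrow> (\<exists>ps. sorted_wrt (<) ps \<and> js = map i ps)"
  by (simp add: word_of_def subseq_map_iff subseq_sorted_list_of_UNIV_iff)

theorem theorem2p9:
  fixes \<Phi> :: "'a::euclidean_space set"
    and r :: nat
    and \<alpha> \<omega> :: "nat \<Rightarrow> 'a"
    and w :: "'a \<Rightarrow> 'a"
    and i :: "'n::{finite,linorder} \<Rightarrow> nat"
    and m :: "nat \<Rightarrow> int"
    and wt :: 'a
    and c :: "'n \<Rightarrow> 'n \<Rightarrow> int"
    and l :: "'n \<Rightarrow> int"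
  assumes "root_system \<Phi>"
    and "simple_roots \<Phi> r \<alpha>"
    and "fundamental_weights r \<alpha> \<omega>"
    and "\<And>j. i j \<in> {1..r}"
    and "w \<in> weyl_group \<Phi>"
    and "w = word_product \<alpha> (word_of i)"
    and "\<And>p. p \<in> {1..r} \<Longrightarrow> 0 \<le> m p"
    and "wt = (\<Sum>p=1..r. of_int (m p) *\<^sub>R \<omega> p)"
    and "\<And>j k. j < k \<Longrightarrow> of_int (c j k) = root_pairing (\<alpha> (i k)) (\<alpha> (i j))"
    and "\<And>j. of_int (l j) = root_pairing wt (\<alpha> (i j))"
  shows "untwisted (twisted_cube c l) (cube_density c l)
     \<longleftrightarrow> hesitant_walk_avoiding r \<alpha> wt (word_of i)"
proof -
  have inj: "inj_on \<alpha> {1..r}"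
    using assms(2) by (simp add: simple_roots_def)
  have nonzero: "\<alpha> p \<noteq> 0" if "p \<in> {1..r}" for p
  proof -
    have "\<alpha> p \<in> \<Phi>"
      using assms(2) that by (auto simp: simple_roots_def)
    then show ?thesis
      using assms(1) by (auto simp: root_system_def)
  qed
  have weight: "root_pairing wt (\<alpha> p) = of_int (m p)" if p: "p \<in> {1..r}" for p
  proof -
    have "root_pairing wt (\<alpha> p) = (\<Sum>k=1..r. of_int (m k) * root_pairing (\<omega> k) (\<alpha> p))"
      by (simp add: assms(8) root_pairing_def inner_sum_left)
    also have "\<dots> = (\<Sum>k=1..r. of_int (m k) * (if k = p then 1 else 0))"
      using assms(3) p by (intro sum.cong) (auto simp: fundamental_weights_def)
    also have "\<dots> = of_int (m p)"
      using p by (simp add: if_distrib cong: if_cong)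
    finally show ?thesis .
  qed
  \<comment> \<open>The first index of the matrix is that of the coroot.\<close>
  interpret cartan_cube i "\<lambda>p q. root_pairing (\<alpha> q) (\<alpha> p)" "\<lambda>p. root_pairing wt (\<alpha> p)" c l
  proof
    show "root_pairing (\<alpha> (i j)) (\<alpha> (i j)) = 2" for j
      using nonzero[OF assms(4)] by (simp add: root_pairing_eq)
    show "root_pairing (\<alpha> (i k)) (\<alpha> (i j)) \<le> 0" if "i j \<noteq> i k" for j k
      using root_pairing_simple_roots_nonpos[OF assms(1,2) assms(4) assms(4)] that by metis
    show "0 \<le> root_pairing wt (\<alpha> (i j))" for j
      using weight[OF assms(4)] assms(7)[OF assms(4)] by simp
  qed (use assms(9,10) in auto)
  \<comment> \<open>The number of edges is a product of two Cartan integers that vanish together.\<close>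
  have joined: "dynkin_joined \<alpha> (i j) (i k) \<longleftrightarrow>
      i j \<noteq> i k \<and> root_pairing (\<alpha> (i k)) (\<alpha> (i j)) < 0" for j k
  proof -
    have "\<alpha> (i j) \<noteq> \<alpha> (i k) \<longleftrightarrow> i j \<noteq> i k"
      using inj_on_eq_iff[OF inj assms(4) assms(4)] by simp
    moreover have "dynkin_edges \<alpha> (i j) (i k) \<noteq> 0 \<longleftrightarrow> root_pairing (\<alpha> (i k)) (\<alpha> (i j)) \<noteq> 0"
      using nonzero[OF assms(4)] by (auto simp: dynkin_edges_def root_pairing_eq inner_commute)
    ultimately show ?thesis
      using off_diagonal[of j k] by (auto simp: dynkin_joined_def)
  qed
  have walk: "diagram_walk r \<alpha> (map i ps) \<and> appears_in \<alpha> (last (map i ps)) wt \<longleftrightarrow> walk ps" for ps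
    using assms(4) by (auto simp: diagram_walk_def walk_def appears_in_def successively_map joined
        last_map)
  have hesitant: "sorted_wrt (<) ps \<and> hesitant_walk r \<alpha> wt (map i ps) \<longleftrightarrow> hesitant ps" for ps
  proof (cases "2 \<le> length ps")
    case True
    then obtain p q qs where ps: "ps = p # q # qs"
      by (metis One_nat_def Suc_1 Suc_le_length_iff)
    show ?thesis
      using walk[of "q # qs"] by (auto simp: ps hesitant_walk_def hesitant_def)
  qed (auto simp: hesitant_walk_def hesitant_def)
  have "hesitant_walk_avoiding r \<alpha> wt (word_of i) \<longleftrightarrow> (\<forall>ps. \<not> hesitant ps)"
    unfolding hesitant_walk_avoiding_def subseq_word_of_iff hesitant[symmetric] by blast
  then show ?thesis
    by (simp add: untwisted_iff_no_hesitant)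
qed

end
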